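(* Assume the Proper Forcing Axiom (PFA). Then the following hold for Tychonoff spaces. (1) Every countably compact $\Delta$-space is compact. (2) Every countably compact $\Delta$-space has countable tightness. (3) Every countably compact $\Delta$-space (hence, every compact $\Delta$-space) is sequential.
   Context: A topological space $X$ is a $\Delta$-space if for every decreasing sequence $\{D_n: n \in \omega\}$ of subsets of $X$ with empty intersection there is a decreasing sequence $\{V_n: n \in \omega\}$ of open subsets of $X$, also with empty intersection, such that $D_n \subset V_n$ for every $n \in \omega$. A space $X$ has countable tightness if for each $A \subset X$ and each $x$ in the closure of $A$ there is a countable $B \subset A$ such that $x$ is in the closure of $B$. A set $A \subset X$ is sequentially closed if whenever a sequence of points of $A$ converges to $x \in X$, then $x\in A$; $X$ is sequential if every sequentially closed subset of $X$ is closed. *)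

theory Defs
  imports "HOL-Analysis.Analysis"
begin

unbundle cardinal_syntax

section \<open>Classes of topological spaces\<close>

definition tychonoff_space :: "'a topology \<Rightarrow> bool" where
  "tychonoff_space X \<longleftrightarrow> completely_regular_space X \<and> t1_space X"

definition countably_compact_space :: "'a topology \<Rightarrow> bool" where
  "countably_compact_space X \<longleftrightarrow>
     (\<forall>\<U>. countable \<U> \<and> (\<forall>U\<in>\<U>. openin X U) \<and> topspace X \<subseteq> \<Union>\<U>
        \<longrightarrow> (\<exists>\<F>. finite \<F> \<and> \<F> \<subseteq> \<U> \<and> topspace X \<subseteq> \<Union>\<F>))"

definition Delta_space :: "'a topology \<Rightarrow> bool" where
  "Delta_space X \<longleftrightarrow>
     (\<forall>D :: nat \<Rightarrow> 'a set.
        (\<forall>n. D n \<subseteq> topspace X) \<and> decseq D \<and> (\<Inter>n. D n) = {}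
        \<longrightarrow> (\<exists>V :: nat \<Rightarrow> 'a set.
              (\<forall>n. openin X (V n)) \<and> decseq V \<and> (\<Inter>n. V n) = {} \<and> (\<forall>n. D n \<subseteq> V n)))"

definition countable_tightness :: "'a topology \<Rightarrow> bool" where
  "countable_tightness X \<longleftrightarrow>
     (\<forall>A x. A \<subseteq> topspace X \<and> x \<in> X closure_of A
        \<longrightarrow> (\<exists>B. B \<subseteq> A \<and> countable B \<and> x \<in> X closure_of B))"

definition sequentially_closedin :: "'a topology \<Rightarrow> 'a set \<Rightarrow> bool" where
  "sequentially_closedin X A \<longleftrightarrow>
     A \<subseteq> topspace X \<and>
     (\<forall>(\<sigma> :: nat \<Rightarrow> 'a) x. range \<sigma> \<subseteq> A \<and> limitin X \<sigma> x sequentially \<longrightarrow> x \<in> A)"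

definition sequential_space :: "'a topology \<Rightarrow> bool" where
  "sequential_space X \<longleftrightarrow> (\<forall>A. sequentially_closedin X A \<longrightarrow> closedin X A)"


section \<open>Elementary submodels of \<open>H(\<theta>)\<close>\<close>

text \<open>First-order formulas in the language of set theory, with named variables.\<close>

datatype set_formula =
    Equal nat nat
  | Member nat nat
  | Neg set_formula
  | Conj set_formula set_formula
  | Exists nat set_formula

primrec satisfies ::
    "'h set \<Rightarrow> ('h \<Rightarrow> 'h \<Rightarrow> bool) \<Rightarrow> (nat \<Rightarrow> 'h) \<Rightarrow> set_formula \<Rightarrow> bool" where
  "satisfies U E s (Equal i j) \<longleftrightarrow> s i = s j"
| "satisfies U E s (Member i j) \<longleftrightarrow> E (s i) (s j)"
| "satisfies U E s (Neg \<phi>) \<longleftrightarrow> \<not> satisfies U E s \<phi>"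
| "satisfies U E s (Conj \<phi> \<psi>) \<longleftrightarrow> satisfies U E s \<phi> \<and> satisfies U E s \<psi>"
| "satisfies U E s (Exists i \<phi>) \<longleftrightarrow> (\<exists>x\<in>U. satisfies U E (s(i := x)) \<phi>)"

definition elementary_submodel ::
    "'h set \<Rightarrow> 'h set \<Rightarrow> ('h \<Rightarrow> 'h \<Rightarrow> bool) \<Rightarrow> bool" where
  "elementary_submodel M U E \<longleftrightarrow>
     M \<noteq> {} \<and> M \<subseteq> U \<and>
     (\<forall>\<phi> s. range s \<subseteq> M \<longrightarrow> satisfies M E s \<phi> = satisfies U E s \<phi>)"

text \<open>\<open>represents U E y A\<close>: the element \<open>y\<close> of the structure \<open>(U, E)\<close> is the set \<open>A\<close>.\<close>

definition represents :: "'h set \<Rightarrow> ('h \<Rightarrow> 'h \<Rightarrow> bool) \<Rightarrow> 'h \<Rightarrow> 'h set \<Rightarrow> bool" where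
  "represents U E y A \<longleftrightarrow> y \<in> U \<and> {x \<in> U. E x y} = A"

text \<open>The Kuratowski pair, \<open>z = {{x}, {x, y}}\<close>.\<close>

definition is_pair :: "'h set \<Rightarrow> ('h \<Rightarrow> 'h \<Rightarrow> bool) \<Rightarrow> 'h \<Rightarrow> 'h \<Rightarrow> 'h \<Rightarrow> bool" where
  "is_pair U E x y z \<longleftrightarrow>
     (\<exists>s d. represents U E s {x} \<and> represents U E d {x, y} \<and> represents U E z {s, d})"

definition uncountable_regular_cardinal :: "'h rel \<Rightarrow> bool" where
  "uncountable_regular_cardinal \<theta> \<longleftrightarrow> Card_order \<theta> \<and> natLeq <o \<theta> \<and> regularCard \<theta>"

text \<open>
  For a regular cardinal \<open>\<theta>\<close>, this says that \<open>(U, E)\<close> is isomorphic to \<open>(H(\<theta>), \<in>)\<close>, where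
  \<open>H(\<theta>)\<close> is the set of all sets whose transitive closure has fewer than \<open>\<theta>\<close> elements:
  \<open>(U, E)\<close> is well-founded and extensional, and the subsets of \<open>U\<close> represented by elements
  of \<open>U\<close> are exactly those with fewer than \<open>\<theta>\<close> elements. By regularity of \<open>\<theta>\<close> the Mostowski
  collapse of such a structure is \<open>H(\<theta>)\<close>.
\<close>

definition is_H :: "'h rel \<Rightarrow> 'h set \<Rightarrow> ('h \<Rightarrow> 'h \<Rightarrow> bool) \<Rightarrow> bool" where
  "is_H \<theta> U E \<longleftrightarrow>
     wfp_on U E \<and>
     (\<forall>y\<in>U. |{x \<in> U. E x y}| <o \<theta>) \<and>
     (\<forall>A. A \<subseteq> U \<and> |A| <o \<theta> \<longrightarrow> (\<exists>!y. represents U E y A))"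


section \<open>Proper forcing\<close>

text \<open>A forcing notion is a nonempty preorder; \<open>le q p\<close> means that \<open>q\<close> is stronger than \<open>p\<close>.\<close>

definition forcing_notion :: "'p set \<Rightarrow> ('p \<Rightarrow> 'p \<Rightarrow> bool) \<Rightarrow> bool" where
  "forcing_notion P le \<longleftrightarrow> P \<noteq> {} \<and> reflp_on P le \<and> transp_on P le"

definition compatible_in :: "'p set \<Rightarrow> ('p \<Rightarrow> 'p \<Rightarrow> bool) \<Rightarrow> 'p \<Rightarrow> 'p \<Rightarrow> bool" where
  "compatible_in P le p q \<longleftrightarrow> (\<exists>r\<in>P. le r p \<and> le r q)"

definition dense_in :: "'p set \<Rightarrow> ('p \<Rightarrow> 'p \<Rightarrow> bool) \<Rightarrow> 'p set \<Rightarrow> bool" where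
  "dense_in P le D \<longleftrightarrow> D \<subseteq> P \<and> (\<forall>p\<in>P. \<exists>d\<in>D. le d p)"

definition filter_in :: "'p set \<Rightarrow> ('p \<Rightarrow> 'p \<Rightarrow> bool) \<Rightarrow> 'p set \<Rightarrow> bool" where
  "filter_in P le G \<longleftrightarrow>
     G \<subseteq> P \<and> G \<noteq> {} \<and>
     (\<forall>p\<in>G. \<forall>q\<in>P. le p q \<longrightarrow> q \<in> G) \<and>
     (\<forall>p\<in>G. \<forall>q\<in>G. \<exists>r\<in>G. le r p \<and> le r q)"

text \<open>
  Conditions are not themselves elements of \<open>U\<close>, so the forcing notion is transported into the
  structure \<open>(U, E)\<close> by an injection \<open>e\<close>: the elements \<open>a\<close> and \<open>b\<close> of \<open>U\<close> are (the images of)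
  its underlying set and its ordering.
\<close>

definition forcing_copy ::
    "'h set \<Rightarrow> ('h \<Rightarrow> 'h \<Rightarrow> bool) \<Rightarrow> 'p set \<Rightarrow> ('p \<Rightarrow> 'p \<Rightarrow> bool)
      \<Rightarrow> ('p \<Rightarrow> 'h) \<Rightarrow> 'h \<Rightarrow> 'h \<Rightarrow> bool" where
  "forcing_copy U E P le e a b \<longleftrightarrow>
     inj_on e P \<and> e ` P \<subseteq> U \<and>
     represents U E a (e ` P) \<and>
     represents U E b {z \<in> U. \<exists>p\<in>P. \<exists>q\<in>P. le p q \<and> is_pair U E (e p) (e q) z}"

text \<open>\<open>q\<close> is \<open>(M, P)\<close>-generic: for every dense \<open>D \<in> M\<close>, the set \<open>D \<inter> M\<close> is predense below \<open>q\<close>.\<close>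

definition generic_condition ::
    "'h set \<Rightarrow> ('h \<Rightarrow> 'h \<Rightarrow> bool) \<Rightarrow> 'p set \<Rightarrow> ('p \<Rightarrow> 'p \<Rightarrow> bool)
      \<Rightarrow> ('p \<Rightarrow> 'h) \<Rightarrow> 'h set \<Rightarrow> 'p \<Rightarrow> bool" where
  "generic_condition U E P le e M q \<longleftrightarrow>
     (\<forall>D. dense_in P le D \<and> (\<exists>c\<in>M. represents U E c (e ` D))
        \<longrightarrow> (\<forall>r\<in>P. le r q \<longrightarrow> (\<exists>d\<in>D. e d \<in> M \<and> compatible_in P le r d)))"

text \<open>
  \<open>P\<close> is proper if, for every regular \<open>\<theta> > 2\<^sup>|\<^sup>P\<^sup>|\<close> and every countable \<open>M \<prec> H(\<theta>)\<close> with
  \<open>P \<in> M\<close>, every condition in \<open>M\<close> has an \<open>(M, P)\<close>-generic extension. The validity of this for one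
  such \<open>\<theta>\<close> is equivalent to its validity for all of them. The type \<open>'p set set\<close> has room for
  \<open>H(\<theta>)\<close> where \<open>\<theta>\<close> is the least uncountable regular cardinal above \<open>2\<^sup>|\<^sup>P\<^sup>|\<close>, whenever \<open>'p\<close> is
  infinite, so it is enough to consider structures on that type. (On a finite type \<open>'p\<close> all forcing
  notions are proper, and there is no \<open>H(\<theta>)\<close> to consider.)
\<close>

definition proper_forcing :: "'p set \<Rightarrow> ('p \<Rightarrow> 'p \<Rightarrow> bool) \<Rightarrow> bool" where
  "proper_forcing P le \<longleftrightarrow>
     forcing_notion P le \<and>
     (\<forall>(\<theta> :: 'p set set rel) U E e a b M.
        uncountable_regular_cardinal \<theta> \<and> |Pow P| <o \<theta> \<and> is_H \<theta> U E \<and>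
        forcing_copy U E P le e a b \<and>
        elementary_submodel M U E \<and> countable M \<and> a \<in> M \<and> b \<in> M
        \<longrightarrow> (\<forall>p\<in>P. e p \<in> M \<longrightarrow>
              (\<exists>q\<in>P. le q p \<and> generic_condition U E P le e M q)))"

text \<open>
  The Proper Forcing Axiom for forcing notions whose conditions are of type \<open>'p\<close>. The type has to
  be a parameter since HOL has no quantification over types. The axiom for \<open>'p\<close> covers, up to
  isomorphism, all forcing notions of cardinality at most that of \<open>'p\<close>. The bound \<open>cardSuc natLeq\<close>
  is \<open>\<aleph>\<^sub>1\<close>.
\<close>

definition PFA :: "'p itself \<Rightarrow> bool" where
  "PFA _ \<longleftrightarrow>
     (\<forall>(P :: 'p set) le \<D>.
        proper_forcing P le \<and> (\<forall>D\<in>\<D>. dense_in P le D) \<and> |\<D>| \<le>o cardSuc natLeq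
        \<longrightarrow> (\<exists>G. filter_in P le G \<and> (\<forall>D\<in>\<D>. G \<inter> D \<noteq> {})))"

end

theory Submission
  imports Defs
begin

text \<open>
  The core of the argument is that in a countably compact \<open>\<Delta>\<close>-space no maximal filter of closed
  sets has continuum many members with empty intersection. Let \<open>F\<close> be a maximal
  filter of closed sets in a countably compact space. It is closed under countable intersections,
  so the sets missing some member of \<open>F\<close> form a \<open>\<sigma>\<close>-ideal of null sets, and by maximality a
  closed set either belongs to \<open>F\<close> or is null. This resembles the club filter on \<open>\<omega>\<^sub>1\<close>, with
  non-null sets in the place of stationary sets. The \<open>\<Delta>\<close>-property forbids infinitely many
  disjoint non-null sets \<open>B\<^sub>k\<close>: if open \<open>V\<^sub>n \<supseteq> \<Union>k\<ge>n. B\<^sub>k\<close> had empty intersection, their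
  complements would be closed null sets covering the space. Therefore some non-null set cannot be
  split into two non-null parts, and on it the ideal comes from a \<open>\<sigma>\<close>-complete ultrafilter. Such
  an ultrafilter decides countably many bits of a point \<open>t \<in> 2\<^sup>\<omega>\<close> simultaneously, so the
  space is not a union of \<open>2\<^sup>\<omega>\<close> null sets. In other words, every open cover indexed by
  \<open>2\<^sup>\<omega>\<close> has a finite subcover (\<open>Delta_space_continuum_cover\<close>).

  A regular space with a countable dense set \<open>C\<close> has arbitrarily fine covers indexed by the subsets
  of \<open>C\<close>, so closures of countable sets are compact. If a space \<open>X\<close> as in the theorem were not
  compact, some open cover would have no countable subcover, and one could choose points \<open>x\<^sub>i\<close>
  for \<open>i < \<omega>\<^sub>1\<close>, each outside finite subfamilies covering the closures of the earlier initial
  segments. The union \<open>Y\<close> of the closures of all initial segments is again a countably compact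
  \<open>\<Delta>\<close>-space, since both properties are inherited, but its cover by these \<open>\<omega>\<^sub>1 \<le> 2\<^sup>\<omega>\<close> unions
  has no finite subcover. So \<open>X\<close> is compact
  (\<open>compact_space_if_countably_compact_Delta\<close>).

  The rest follows by applying this to subspaces: every countably compact subspace of \<open>X\<close> is
  compact, hence closed. The union of the closures of the countable subsets of \<open>A\<close> is countably
  compact, hence equal to the closure of \<open>A\<close>, which is countable tightness. A sequentially closed set
  is countably compact as soon as every sequence in \<open>X\<close> has a convergent subsequence, and for
  this it is enough that every nonempty \<open>L \<subseteq> X\<close> has an isolated point: a point isolated among the
  cluster points of a sequence is the limit of a subsequence. If \<open>L\<close> had no isolated point,
  countable tightness would give a countable \<open>Q \<subseteq> L\<close> without isolated points. Removing its
  elements one by one gives dense subsets of \<open>Q\<close> with empty intersection, and the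
  \<open>\<Delta>\<close>-property turns them into open sets that contradict the Baire category theorem in the
  closure of \<open>Q\<close>.
\<close>

section \<open>Countable compactness by cluster points\<close>

definition cluster_point :: "'a topology \<Rightarrow> (nat \<Rightarrow> 'a) \<Rightarrow> 'a \<Rightarrow> bool" where
  "cluster_point X y p \<longleftrightarrow>
     p \<in> topspace X \<and> (\<forall>U. openin X U \<and> p \<in> U \<longrightarrow> (\<exists>\<^sub>\<infinity>n. y n \<in> U))"

lemma cluster_point_in_closedin:
  assumes "cluster_point X y p" "closedin X C" "\<forall>\<^sub>\<infinity>n. y n \<in> C"
  shows "p \<in> C"
proof (rule ccontr)
  assume "p \<notin> C"
  with assms have "\<exists>\<^sub>\<infinity>n. y n \<in> topspace X - C"
    unfolding cluster_point_def by (metis DiffI closedin_def)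
  with assms(3) show False
    by (metis (mono_tags, lifting) DiffD2 frequently_elim1 frequently_def eventually_mono)
qed

text \<open>
  If every point had a neighbourhood containing only finitely many terms, the complements of the
  closures of the tails would form a countable cover, increasing and without finite subcover.
\<close>

lemma countably_compact_space_imp_cluster_point:
  assumes cc: "countably_compact_space X" and y: "range y \<subseteq> topspace X"
  shows "\<exists>p. cluster_point X y p"
proof (rule ccontr)
  assume no: "\<nexists>p. cluster_point X y p"
  define U where "U n = topspace X - X closure_of (y ` {n..})" for n :: nat
  have opU: "openin X (U n)" for n
    unfolding U_def by (simp add: openin_diff)
  have "topspace X \<subseteq> \<Union>(range U)"
  proof
    fix p assume p: "p \<in> topspace X"
    with no obtain V where V: "openin X V" "p \<in> V" "\<not> (\<exists>\<^sub>\<infinity>n. y n \<in> V)"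
      unfolding cluster_point_def by blast
    then obtain n where "\<forall>k\<ge>n. y k \<notin> V"
      by (metis INFM_nat_le)
    with V p have "p \<notin> X closure_of (y ` {n..})"
      by (auto simp: in_closure_of)
    with p show "p \<in> \<Union>(range U)"
      by (auto simp: U_def)
  qed
  moreover have "countable (range U)" "\<forall>V\<in>range U. openin X V"
    using opU by auto
  ultimately obtain \<F> where \<F>: "finite \<F>" "\<F> \<subseteq> range U" "topspace X \<subseteq> \<Union>\<F>"
    using cc[unfolded countably_compact_space_def, rule_format, of "range U"] by auto
  then obtain N where N: "finite N" "\<F> = U ` N"
    by (meson finite_subset_image)
  obtain m where m: "\<forall>n\<in>N. n \<le> m"
    using N(1) finite_nat_set_iff_bounded_le by blast
  have ym: "y m \<in> topspace X"
    using y by blast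
  then obtain n where n: "n \<in> N" "y m \<in> U n"
    using \<F>(3) N(2) by blast
  have "y m \<in> X closure_of (y ` {n..})"
    using m n(1) ym y by (intro subsetD[OF closure_of_subset]) auto
  with n show False
    by (simp add: U_def)
qed

text \<open>
  Cluster points are taken in the ambient space, so that countable compactness of many different
  subspaces can be discussed inside one topology.
\<close>

lemma countably_compact_subtopologyI:
  assumes S: "S \<subseteq> topspace X"
    and cl: "\<And>y :: nat \<Rightarrow> 'a. range y \<subseteq> S \<Longrightarrow> \<exists>p\<in>S. cluster_point X y p"
  shows "countably_compact_space (subtopology X S)"
  unfolding countably_compact_space_def
proof (intro allI impI)
  fix \<U> :: "'a set set"
  assume "countable \<U> \<and> (\<forall>U\<in>\<U>. openin (subtopology X S) U)
            \<and> topspace (subtopology X S) \<subseteq> \<Union>\<U>"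
  then have \<U>: "countable \<U>" "\<And>U. U \<in> \<U> \<Longrightarrow> openin (subtopology X S) U" "S \<subseteq> \<Union>\<U>"
    using S by auto
  show "\<exists>\<F>. finite \<F> \<and> \<F> \<subseteq> \<U> \<and> topspace (subtopology X S) \<subseteq> \<Union>\<F>"
  proof (rule ccontr)
    assume "\<not> ?thesis"
    then have no: "\<And>\<F>. finite \<F> \<Longrightarrow> \<F> \<subseteq> \<U> \<Longrightarrow> \<not> S \<subseteq> \<Union>\<F>"
      by auto
    have ne: "\<U> \<noteq> {}"
      using no[of "{}"] \<U>(3) by auto
    have "\<exists>p. p \<in> S \<and> p \<notin> \<Union>(from_nat_into \<U> ` {..n})" for n
    proof -
      have "from_nat_into \<U> ` {..n} \<subseteq> \<U>"
        using ne by (auto intro: from_nat_into)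
      with no show ?thesis
        by (meson finite_atMost finite_imageI subsetI)
    qed
    then obtain y where y: "\<And>n. y n \<in> S" "\<And>n. y n \<notin> \<Union>(from_nat_into \<U> ` {..n})"
      by metis
    then obtain p where p: "p \<in> S" "cluster_point X y p"
      using cl by blast
    then obtain U where U: "U \<in> \<U>" "p \<in> U"
      using \<U>(3) by blast
    then obtain n where n: "U = from_nat_into \<U> n"
      using from_nat_into_surj \<U>(1) by metis
    obtain V where V: "openin X V" "U = V \<inter> S"
      using \<U>(2)[OF U(1)] by (auto simp: openin_subtopology)
    then have "\<exists>\<^sub>\<infinity>k. y k \<in> V"
      using p(2) U(2) unfolding cluster_point_def by blast
    then obtain k where "k \<ge> n" "y k \<in> V"
      by (meson INFM_nat_le)
    then show False
      using y(1)[of k] y(2)[of k] V(2) n by auto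
  qed
qed

lemma countably_compact_space_imp_cluster_point_subtopology:
  assumes "countably_compact_space (subtopology X S)" "range y \<subseteq> S" "S \<subseteq> topspace X"
  shows "\<exists>p\<in>S. cluster_point X y p"
proof -
  obtain p where p: "cluster_point (subtopology X S) y p"
    using countably_compact_space_imp_cluster_point[OF assms(1), of y] assms(2,3) by auto
  have "\<exists>\<^sub>\<infinity>n. y n \<in> U" if "openin X U" "p \<in> U" for U
  proof -
    have "\<exists>\<^sub>\<infinity>n. y n \<in> U \<inter> S"
      using p that unfolding cluster_point_def
      by (metis IntI openin_subtopology_Int topspace_subtopology IntD2)
    then show ?thesis
      by (rule frequently_elim1) auto
  qed
  with p show ?thesis
    by (auto simp: cluster_point_def)
qed

lemma countably_compact_closedin:
  assumes "countably_compact_space X" "closedin X C"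
  shows "countably_compact_space (subtopology X C)"
proof (rule countably_compact_subtopologyI)
  show C: "C \<subseteq> topspace X"
    by (simp add: assms(2) closedin_subset)
  fix y :: "nat \<Rightarrow> 'a" assume y: "range y \<subseteq> C"
  then obtain p where p: "cluster_point X y p"
    using countably_compact_space_imp_cluster_point[OF assms(1)] C by blast
  moreover have "p \<in> C"
    using y by (intro cluster_point_in_closedin[OF p assms(2)]) (auto simp: MOST_nat)
  ultimately show "\<exists>p\<in>C. cluster_point X y p"
    by blast
qed

text \<open>
  The range of a sequence is countable, so the closed set \<open>K\<close> that contains it also contains a
  cluster point. This is how unions of closures of countable sets are seen to be countably compact.
\<close>

lemma countably_compact_subtopology_if_countable_in_closed:
  assumes S: "S \<subseteq> topspace X"
    and K: "\<And>C. countable C \<Longrightarrow> C \<subseteq> S \<Longrightarrow>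
              \<exists>K. C \<subseteq> K \<and> K \<subseteq> S \<and> closedin X K"
    and X: "countably_compact_space X"
  shows "countably_compact_space (subtopology X S)"
proof (rule countably_compact_subtopologyI[OF S])
  fix y :: "nat \<Rightarrow> 'a" assume "range y \<subseteq> S"
  then obtain K where K: "range y \<subseteq> K" "K \<subseteq> S" "closedin X K"
    using K[of "range y"] by auto
  then have "\<exists>p\<in>K. cluster_point X y p"
    using countably_compact_space_imp_cluster_point_subtopology countably_compact_closedin[OF X]
      closedin_subset by metis
  with K show "\<exists>p\<in>S. cluster_point X y p"
    by blast
qed

lemma Delta_space_subtopology:
  assumes "Delta_space X"
  shows "Delta_space (subtopology X S)"
  unfolding Delta_space_def
proof (intro allI impI)
  fix D :: "nat \<Rightarrow> 'a set"
  assume D: "(\<forall>n. D n \<subseteq> topspace (subtopology X S)) \<and> decseq D \<and> (\<Inter>n. D n) = {}"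
  then have "(\<forall>n. D n \<subseteq> topspace X) \<and> decseq D \<and> (\<Inter>n. D n) = {}"
    by auto
  then obtain V :: "nat \<Rightarrow> 'a set" where
    V: "\<forall>n. openin X (V n)" "decseq V" "(\<Inter>n. V n) = {}" "\<forall>n. D n \<subseteq> V n"
    using assms[unfolded Delta_space_def, rule_format, of D] by auto
  show "\<exists>V. (\<forall>n. openin (subtopology X S) (V n)) \<and> decseq V \<and> (\<Inter>n. V n) = {} \<and> (\<forall>n. D n \<subseteq> V n)"
  proof (intro exI conjI allI)
    show "openin (subtopology X S) (V n \<inter> S)" for n
      using V(1) by (simp add: openin_subtopology_Int)
    show "decseq (\<lambda>n. V n \<inter> S)"
      using V(2) by (auto simp: decseq_def)
    show "(\<Inter>n. V n \<inter> S) = {}"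
      using V(3) by auto
    show "D n \<subseteq> V n \<inter> S" for n
      using D V(4) by auto
  qed
qed

section \<open>Maximal filters of closed sets\<close>

text \<open>
  The last clause says that \<open>F\<close> is a maximal filter of closed sets.
\<close>

definition closed_ultrafilter :: "'a topology \<Rightarrow> 'a set set \<Rightarrow> bool" where
  "closed_ultrafilter X F \<longleftrightarrow>
     (\<forall>C\<in>F. closedin X C \<and> C \<noteq> {}) \<and> F \<noteq> {} \<and>
     (\<forall>A\<in>F. \<forall>B\<in>F. A \<inter> B \<in> F) \<and>
     (\<forall>C. closedin X C \<and> (\<forall>A\<in>F. C \<inter> A \<noteq> {}) \<longrightarrow> C \<in> F)"

lemma closed_ultrafilter_exists:
  assumes closed: "\<And>C. C \<in> \<G> \<Longrightarrow> closedin X C"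
    and fip: "\<And>\<H>. finite \<H> \<Longrightarrow> \<H> \<subseteq> \<G> \<Longrightarrow> topspace X \<inter> \<Inter>\<H> \<noteq> {}"
  shows "\<exists>F. closed_ultrafilter X F \<and> \<G> \<subseteq> F"
proof -
  define Fam where "Fam = {F. \<G> \<subseteq> F \<and> (\<forall>C\<in>F. closedin X C) \<and>
      (\<forall>\<H>. finite \<H> \<and> \<H> \<subseteq> F \<longrightarrow> topspace X \<inter> \<Inter>\<H> \<noteq> {})}"
  have "\<exists>M\<in>Fam. \<forall>F\<in>Fam. M \<subseteq> F \<longrightarrow> F = M"
  proof (rule subset_Zorn_nonempty)
    show "Fam \<noteq> {}"
      using closed fip by (auto simp: Fam_def)
    fix \<C> assume \<C>: "\<C> \<noteq> {}" "subset.chain Fam \<C>"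
    have sub: "\<C> \<subseteq> Fam"
      using \<C>(2) by (simp add: subset.chain_def)
    have sub1: "\<G> \<subseteq> F" "\<forall>C\<in>F. closedin X C" if "F \<in> \<C>" for F
      using subsetD[OF sub that] by (simp_all add: Fam_def)
    have sub2: "topspace X \<inter> \<Inter>\<H> \<noteq> {}" if "F \<in> \<C>" "finite \<H>" "\<H> \<subseteq> F" for F \<H>
      using subsetD[OF sub that(1)] that(2,3) by (simp add: Fam_def)
    have fin: "topspace X \<inter> \<Inter>\<H> \<noteq> {}" if \<H>: "finite \<H>" "\<H> \<subseteq> \<Union>\<C>" for \<H>
    proof -
      obtain F where "F \<in> \<C>" "\<H> \<subseteq> F"
        by (rule finite_subset_Union_chain[OF \<H> \<C>])
      with \<H>(1) show ?thesis
        by (intro sub2)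
    qed
    obtain F where "F \<in> \<C>"
      using \<C>(1) by blast
    then have "\<G> \<subseteq> \<Union>\<C>"
      using sub1(1) by blast
    moreover have "closedin X C" if "C \<in> \<Union>\<C>" for C
      using sub1(2) that by blast
    ultimately show "\<Union>\<C> \<in> Fam"
      using fin by (simp add: Fam_def)
  qed
  then obtain M where M: "M \<in> Fam" and max: "\<And>F. F \<in> Fam \<Longrightarrow> M \<subseteq> F \<Longrightarrow> F = M"
    by blast
  have M1: "\<G> \<subseteq> M" "\<And>C. C \<in> M \<Longrightarrow> closedin X C"
    and M2: "\<And>\<H>. finite \<H> \<Longrightarrow> \<H> \<subseteq> M \<Longrightarrow> topspace X \<inter> \<Inter>\<H> \<noteq> {}"
    using M by (auto simp: Fam_def)
  have add: "C \<in> M" if C: "closedin X C"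
    and meets: "\<And>\<H>. finite \<H> \<Longrightarrow> \<H> \<subseteq> M \<Longrightarrow> topspace X \<inter> \<Inter>\<H> \<inter> C \<noteq> {}" for C
  proof -
    have "topspace X \<inter> \<Inter>\<H> \<noteq> {}" if "finite \<H>" "\<H> \<subseteq> insert C M" for \<H>
      using meets[of "\<H> - {C}"] that by auto
    then have "insert C M \<in> Fam"
      using M1 C by (auto simp: Fam_def)
    with max show ?thesis
      by blast
  qed
  have top: "topspace X \<inter> \<Inter>\<H> \<in> M" if "finite \<H>" "\<H> \<subseteq> M" for \<H>
  proof (rule add)
    show "closedin X (topspace X \<inter> \<Inter>\<H>)"
      using that M1(2) by (metis closedin_Inter closedin_Int closedin_topspace inf_top_right
          Inter_empty subset_iff)
    fix \<H>' assume "finite \<H>'" "\<H>' \<subseteq> M"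
    with that M2[of "\<H> \<union> \<H>'"] show "topspace X \<inter> \<Inter>\<H>' \<inter> (topspace X \<inter> \<Inter>\<H>) \<noteq> {}"
      by auto
  qed
  have "closed_ultrafilter X M"
    unfolding closed_ultrafilter_def
  proof (intro conjI ballI allI impI)
    show "M \<noteq> {}"
      using top[of "{}"] by auto
    show "closedin X C" if "C \<in> M" for C
      using M1(2) that by blast
    show "C \<noteq> {}" if "C \<in> M" for C
      using M2[of "{C}"] that by auto
    show "A \<inter> B \<in> M" if "A \<in> M" "B \<in> M" for A B
    proof -
      have "topspace X \<inter> \<Inter>{A, B} = A \<inter> B"
        using closedin_subset[OF M1(2)] that by auto
      with top[of "{A, B}"] that show ?thesis
        by simp
    qed
    show "C \<in> M" if "closedin X C \<and> (\<forall>A\<in>M. C \<inter> A \<noteq> {})" for C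
    proof (rule add)
      show "closedin X C"
        using that by blast
      fix \<H> assume "finite \<H>" "\<H> \<subseteq> M"
      with top that show "topspace X \<inter> \<Inter>\<H> \<inter> C \<noteq> {}"
        by (metis inf_commute)
    qed
  qed
  with M1(1) show ?thesis
    by blast
qed

text \<open>
  By maximality it suffices that the intersection meets each \<open>A \<in> F\<close>. A cluster point of a
  sequence running through the decreasing sets \<open>A \<inter> (\<Inter>i\<le>n. C i)\<close> is a common point.
\<close>

lemma closed_ultrafilter_countable_Inter:
  fixes C :: "nat \<Rightarrow> 'a set"
  assumes cc: "countably_compact_space X" and F: "closed_ultrafilter X F"
    and C: "\<And>n. C n \<in> F"
  shows "(\<Inter>n. C n) \<in> F"
proof -
  have F1: "\<And>A. A \<in> F \<Longrightarrow> closedin X A" "\<And>A. A \<in> F \<Longrightarrow> A \<noteq> {}"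
    and F2: "\<And>A B. A \<in> F \<Longrightarrow> B \<in> F \<Longrightarrow> A \<inter> B \<in> F"
    and F3: "\<And>D. closedin X D \<Longrightarrow> (\<And>A. A \<in> F \<Longrightarrow> D \<inter> A \<noteq> {}) \<Longrightarrow> D \<in> F"
    using F unfolding closed_ultrafilter_def by blast+
  show ?thesis
  proof (rule F3)
    show "closedin X (\<Inter>n. C n)"
      using F1(1) C by auto
    fix A assume A: "A \<in> F"
    have fin: "A \<inter> (\<Inter>i\<le>n. C i) \<in> F" for n
    proof (induction n)
      case 0
      then show ?case using A C F2 by simp
    next
      case (Suc n)
      have "A \<inter> (\<Inter>i\<le>Suc n. C i) = (A \<inter> (\<Inter>i\<le>n. C i)) \<inter> C (Suc n)"
        by (auto simp: atMost_Suc)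
      with Suc C F2 show ?case by metis
    qed
    then have "\<forall>n. \<exists>p. p \<in> A \<inter> (\<Inter>i\<le>n. C i)"
      using F1(2) by blast
    then obtain y where y: "\<And>n. y n \<in> A \<inter> (\<Inter>i\<le>n. C i)"
      by metis
    have "range y \<subseteq> topspace X"
      using y closedin_subset[OF F1(1)[OF A]] by blast
    then obtain p where p: "cluster_point X y p"
      using countably_compact_space_imp_cluster_point[OF cc] by blast
    have "p \<in> A"
      using y by (intro cluster_point_in_closedin[OF p F1(1)[OF A]]) (auto simp: MOST_nat)
    moreover have "p \<in> C n" for n
    proof (rule cluster_point_in_closedin[OF p F1(1)[OF C]])
      show "\<forall>\<^sub>\<infinity>k. y k \<in> C n"
        unfolding MOST_nat_le using y by blast
    qed
    ultimately show "(\<Inter>n. C n) \<inter> A \<noteq> {}"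
      by blast
  qed
qed

text \<open>
  The ideal dual to the filter generated by \<open>F\<close>. For the filter of closed unbounded subsets of
  \<open>\<omega>\<^sub>1\<close> the sets outside this ideal are the stationary ones.
\<close>

definition null_set :: "'a set set \<Rightarrow> 'a set \<Rightarrow> bool" where
  "null_set F S \<longleftrightarrow> (\<exists>A\<in>F. S \<inter> A = {})"

lemma null_set_subset: "null_set F T \<Longrightarrow> S \<subseteq> T \<Longrightarrow> null_set F S"
  unfolding null_set_def by blast

lemma null_set_countable_UN:
  fixes S :: "nat \<Rightarrow> 'a set"
  assumes "countably_compact_space X" "closed_ultrafilter X F" "\<And>n. null_set F (S n)"
  shows "null_set F (\<Union>n. S n)"
proof -
  obtain A where A: "\<And>n. A n \<in> F" "\<And>n. S n \<inter> A n = {}"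
    using assms(3) unfolding null_set_def by metis
  then have "(\<Inter>n. A n) \<in> F"
    using closed_ultrafilter_countable_Inter[OF assms(1,2)] by blast
  moreover have "(\<Union>n. S n) \<inter> (\<Inter>n. A n) = {}"
    using A(2) by blast
  ultimately show ?thesis
    unfolding null_set_def by blast
qed

lemma null_set_Un:
  assumes "countably_compact_space X" "closed_ultrafilter X F" "null_set F S" "null_set F T"
  shows "null_set F (S \<union> T)"
proof -
  have "null_set F (\<Union>n::nat. if n = 0 then S else T)"
    using assms by (intro null_set_countable_UN) auto
  then show ?thesis
    by (rule null_set_subset) (auto split: if_splits intro: exI[of _ 1] exI[of _ 0])
qed

lemma not_null_topspace:
  assumes "closed_ultrafilter X F"
  shows "\<not> null_set F (topspace X)"
  using assms closedin_subset unfolding closed_ultrafilter_def null_set_def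
  by (metis inf.absorb_iff2)

section \<open>The null ideal of a countably compact \<open>\<Delta>\<close>-space\<close>

text \<open>
  The \<open>\<Delta>\<close>-property is applied to the sets \<open>D n = (\<Union>k\<ge>n. B k)\<close>. A closed set missing the
  non-null \<open>D n\<close> is not in \<open>F\<close>, hence null; so the complements of the expansions \<open>V n\<close> would
  exhaust the space by countably many null sets.
\<close>

lemma Delta_space_no_disjoint_positive:
  fixes B :: "nat \<Rightarrow> 'a set"
  assumes cc: "countably_compact_space X" and "Delta_space X" and F: "closed_ultrafilter X F"
    and B: "\<And>n. B n \<subseteq> topspace X" "disjoint_family B"
  shows "\<exists>n. null_set F (B n)"
proof (rule ccontr)
  assume "\<not> ?thesis"
  then have pos: "\<not> null_set F (B n)" for n
    by blast
  define D where "D n = (\<Union>k\<in>{n..}. B k)" for n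
  have "(\<Inter>n. D n) = {}"
  proof (intro equals0I)
    fix x assume "x \<in> (\<Inter>n. D n)"
    then have "\<exists>k\<ge>n. x \<in> B k" for n
      by (auto simp: D_def)
    then obtain k l where "x \<in> B k" "x \<in> B l" "k < l"
      by (meson Suc_le_lessD)
    with B(2) show False
      unfolding disjoint_family_on_def by (metis UNIV_I disjoint_iff less_irrefl)
  qed
  moreover have "\<forall>n. D n \<subseteq> topspace X" "decseq D"
    using B(1) by (force simp: D_def decseq_def)+
  ultimately obtain V where
    V: "\<And>n. openin X (V n)" "(\<Inter>n. V n) = {}" "\<And>n. D n \<subseteq> V n"
    using assms(2)[unfolded Delta_space_def, rule_format, of D] by auto
  have "null_set F (topspace X - V n)" for n
  proof (rule ccontr)
    assume "\<not> null_set F (topspace X - V n)"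
    moreover have "closedin X (topspace X - V n)"
      using V(1) by blast
    ultimately have "topspace X - V n \<in> F"
      using F unfolding closed_ultrafilter_def null_set_def by blast
    moreover have "B n \<inter> (topspace X - V n) = {}"
      using V(3)[of n] by (auto simp: D_def)
    ultimately have "null_set F (B n)"
      unfolding null_set_def by blast
    with pos show False
      by blast
  qed
  then have "null_set F (\<Union>n. topspace X - V n)"
    by (rule null_set_countable_UN[OF cc F])
  then have "null_set F (topspace X)"
    by (rule null_set_subset) (use V(2) in auto)
  with not_null_topspace[OF F] show False
    by blast
qed

text \<open>
  Otherwise one could split off non-null pieces forever, starting from the whole space, and the
  differences of consecutive remainders would be disjoint and non-null.
\<close>

lemma positive_atom_exists:
  assumes cc: "countably_compact_space X" and "Delta_space X" and F: "closed_ultrafilter X F"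
  shows "\<exists>S\<subseteq>topspace X. \<not> null_set F S \<and> (\<forall>A\<subseteq>S. null_set F A \<or> null_set F (S - A))"
proof (rule ccontr)
  assume "\<not> ?thesis"
  then have "\<forall>S. \<exists>A. S \<subseteq> topspace X \<and> \<not> null_set F S \<longrightarrow>
               A \<subseteq> S \<and> \<not> null_set F A \<and> \<not> null_set F (S - A)"
    by blast
  then obtain h where h: "\<And>S. S \<subseteq> topspace X \<Longrightarrow> \<not> null_set F S \<Longrightarrow>
               h S \<subseteq> S \<and> \<not> null_set F (h S) \<and> \<not> null_set F (S - h S)"
    by metis
  define S where "S n = (h ^^ n) (topspace X)" for n
  have S_Suc: "S (Suc n) = h (S n)" for n
    by (simp add: S_def)
  have S: "S n \<subseteq> topspace X \<and> \<not> null_set F (S n)" for n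
  proof (induction n)
    case 0
    then show ?case using not_null_topspace[OF F] by (simp add: S_def)
  next
    case (Suc n)
    then show ?case using h[of "S n"] unfolding S_Suc by blast
  qed
  have S_dec: "S (Suc n) \<subseteq> S n" for n
    using h S unfolding S_Suc by blast
  then have anti: "S n \<subseteq> S m" if "m \<le> n" for m n
    using that by (rule lift_Suc_antimono_le)
  have disj: "disjoint_family (\<lambda>n. S n - S (Suc n))"
    unfolding disjoint_family_on_def
  proof (intro ballI impI)
    have "(S m - S (Suc m)) \<inter> (S n - S (Suc n)) = {}" if "m < n" for m n
      using anti[of "Suc m" n] that by auto
    then show "(S m - S (Suc m)) \<inter> (S n - S (Suc n)) = {}" if "m \<noteq> n" for m n
      using that by (metis Int_commute nat_neq_iff)
  qed
  have "\<exists>n. null_set F (S n - S (Suc n))"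
    using Delta_space_no_disjoint_positive[OF assms _ disj] S by blast
  then show False
    using h S unfolding S_Suc by blast
qed

text \<open>
  On an atom \<open>S\<close> the non-null sets form a \<open>\<sigma>\<close>-complete ultrafilter. Label each \<open>x \<in> S\<close> by some
  \<open>t x\<close> with \<open>x \<in> V (t x)\<close>. For each \<open>n\<close> almost all labels agree about \<open>n\<close>, so almost all
  labels are equal to one set \<open>r\<close>, and the null set \<open>V r\<close> would contain almost all of \<open>S\<close>.
\<close>

lemma null_set_continuum_UN:
  fixes V :: "nat set \<Rightarrow> 'a set"
  assumes cc: "countably_compact_space X" and "Delta_space X" and F: "closed_ultrafilter X F"
    and V: "\<And>t. null_set F (V t)"
  shows "\<not> topspace X \<subseteq> (\<Union>t. V t)"
proof
  assume cover: "topspace X \<subseteq> (\<Union>t. V t)"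
  obtain S where S: "S \<subseteq> topspace X" "\<not> null_set F S"
    and atom: "\<And>A. A \<subseteq> S \<Longrightarrow> null_set F A \<or> null_set F (S - A)"
    using positive_atom_exists[OF assms(1-3)] by blast
  obtain t where t: "\<And>x. x \<in> S \<Longrightarrow> x \<in> V (t x)"
    using cover S(1) by (metis UN_iff subset_iff)
  \<comment> \<open>The value of the label on which almost all points of \<open>S\<close> agree.\<close>
  define r where "r = {n. null_set F {x\<in>S. n \<notin> t x}}"
  have "null_set F {x\<in>S. n \<in> t x \<longleftrightarrow> n \<notin> r}" for n
  proof (cases "n \<in> r")
    case True
    then show ?thesis by (simp add: r_def)
  next
    case False
    have "S - {x\<in>S. n \<notin> t x} = {x\<in>S. n \<in> t x}"
      by blast
    with False atom[of "{x\<in>S. n \<notin> t x}"] show ?thesis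
      by (auto simp: r_def)
  qed
  then have "null_set F (\<Union>n. {x\<in>S. n \<in> t x \<longleftrightarrow> n \<notin> r})"
    by (rule null_set_countable_UN[OF cc F])
  then have "null_set F ((\<Union>n. {x\<in>S. n \<in> t x \<longleftrightarrow> n \<notin> r}) \<union> V r)"
    using V by (rule null_set_Un[OF cc F])
  moreover have "S \<subseteq> (\<Union>n. {x\<in>S. n \<in> t x \<longleftrightarrow> n \<notin> r}) \<union> V r"
  proof
    fix x assume "x \<in> S"
    then show "x \<in> (\<Union>n. {x\<in>S. n \<in> t x \<longleftrightarrow> n \<notin> r}) \<union> V r"
      using t[of x] by (cases "t x = r") auto
  qed
  ultimately show False
    using S(2) null_set_subset by blast
qed

text \<open>
  The index type \<open>nat set\<close> stands for any index set of size at most the continuum: unused indices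
  can be given the empty open set.
\<close>

lemma Delta_space_continuum_cover:
  fixes V :: "nat set \<Rightarrow> 'a set"
  assumes cc: "countably_compact_space X" and D: "Delta_space X"
    and op: "\<And>t. openin X (V t)" and cover: "topspace X \<subseteq> (\<Union>t. V t)"
  shows "\<exists>T. finite T \<and> topspace X \<subseteq> (\<Union>t\<in>T. V t)"
proof (rule ccontr)
  assume no: "\<not> ?thesis"
  define \<G> where "\<G> = range (\<lambda>t. topspace X - V t)"
  have "\<exists>F. closed_ultrafilter X F \<and> \<G> \<subseteq> F"
  proof (rule closed_ultrafilter_exists)
    show "closedin X C" if "C \<in> \<G>" for C
      using that op by (auto simp: \<G>_def)
    fix \<H> assume "finite \<H>" "\<H> \<subseteq> \<G>"
    then obtain T where T: "finite T" "\<H> = (\<lambda>t. topspace X - V t) ` T"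
      unfolding \<G>_def by (meson finite_subset_image)
    with no have "\<not> topspace X \<subseteq> (\<Union>t\<in>T. V t)"
      by blast
    with T(2) show "topspace X \<inter> \<Inter>\<H> \<noteq> {}"
      by auto
  qed
  then obtain F where F: "closed_ultrafilter X F" "\<G> \<subseteq> F"
    by blast
  have "null_set F (V t)" for t
    using F(2) unfolding null_set_def \<G>_def by blast
  with null_set_continuum_UN[OF cc D F(1)] cover show False
    by blast
qed

section \<open>Compactness\<close>

text \<open>
  If \<open>z \<in> W\<close> with \<open>W\<close> open, then \<open>z\<close> is interior to the closure of \<open>W \<inter> C\<close>. By regularity the
  sets of this form that are small with respect to a given open cover still cover the space, and
  there are only continuum many of them, one for each subset of \<open>C\<close>.
\<close>

lemma compact_space_if_separable_Delta:
  assumes cc: "countably_compact_space X" and D: "Delta_space X" and reg: "regular_space X"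
    and C: "countable C" "C \<subseteq> topspace X" "X closure_of C = topspace X"
  shows "compact_space X"
  unfolding compact_space_def compactin_def
proof (intro conjI allI impI)
  fix \<U> assume "Ball \<U> (openin X) \<and> topspace X \<subseteq> \<Union>\<U>"
  then have \<U>: "\<And>U. U \<in> \<U> \<Longrightarrow> openin X U" "topspace X \<subseteq> \<Union>\<U>"
    by auto
  obtain f :: "'a \<Rightarrow> nat" where f: "inj_on f C"
    using C(1) by (meson countableE)
  define cl where "cl t = X closure_of {x\<in>C. f x \<in> t}" for t
  define V where "V t = (if \<exists>U\<in>\<U>. cl t \<subseteq> U then X interior_of (cl t) else {})" for t
  have "topspace X \<subseteq> (\<Union>t. V t)"
  proof
    fix z assume z: "z \<in> topspace X"
    then obtain U where U: "U \<in> \<U>" "z \<in> U"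
      using \<U>(2) by blast
    obtain W K where W: "openin X W" "closedin X K" "z \<in> W" "W \<subseteq> K" "K \<subseteq> U"
      using reg U \<U>(1) unfolding neighbourhood_base_of_closedin[symmetric] neighbourhood_base_of
      by metis
    have "{x\<in>C. f x \<in> f ` (W \<inter> C)} = W \<inter> C"
      using f by (auto simp: inj_on_def)
    then have cl: "cl (f ` (W \<inter> C)) = X closure_of (W \<inter> C)"
      by (simp add: cl_def)
    have "W \<subseteq> X closure_of (W \<inter> C)"
      using openin_Int_closure_of_subset[OF W(1), of C] C(3) openin_subset[OF W(1)] by auto
    moreover have "X closure_of (W \<inter> C) \<subseteq> K"
      by (meson W(2,4) closure_of_minimal inf.coboundedI1)
    ultimately have "z \<in> V (f ` (W \<inter> C))"
      using W(1,3,5) U(1) cl by (auto simp: V_def interior_of_def)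
    then show "z \<in> (\<Union>t. V t)"
      by blast
  qed
  moreover have "openin X (V t)" for t
    by (simp add: V_def)
  ultimately obtain T where T: "finite T" "topspace X \<subseteq> (\<Union>t\<in>T. V t)"
    using Delta_space_continuum_cover[OF cc D] by metis
  define T' where "T' = {t\<in>T. \<exists>U\<in>\<U>. cl t \<subseteq> U}"
  have "\<forall>t\<in>T'. \<exists>U. U \<in> \<U> \<and> cl t \<subseteq> U"
    by (auto simp: T'_def)
  then obtain g where g: "\<And>t. t \<in> T' \<Longrightarrow> g t \<in> \<U> \<and> cl t \<subseteq> g t"
    by (auto dest!: bchoice)
  have "V t \<subseteq> \<Union>(g ` T')" if "t \<in> T" for t
  proof (cases "t \<in> T'")
    case True
    have "V t \<subseteq> cl t"
      using interior_of_subset[of X "cl t"] by (simp add: V_def)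
    with g[OF True] True show ?thesis
      by blast
  next
    case False
    with that show ?thesis
      by (auto simp: V_def T'_def)
  qed
  then have "topspace X \<subseteq> \<Union>(g ` T')"
    using T(2) by blast
  moreover have "finite (g ` T')"
    using T(1) by (simp add: T'_def)
  moreover have "g ` T' \<subseteq> \<U>"
    using g by blast
  ultimately show "\<exists>\<F>. finite \<F> \<and> \<F> \<subseteq> \<U> \<and> topspace X \<subseteq> \<Union>\<F>"
    by blast
qed simp

lemma compactin_closure_of_countable:
  assumes cc: "countably_compact_space X" and D: "Delta_space X" and reg: "regular_space X"
    and A: "countable A"
  shows "compactin X (X closure_of A)"
proof -
  let ?K = "X closure_of A" and ?A = "topspace X \<inter> A"
  have sub: "?A \<subseteq> ?K"
    by (metis closure_of_restrict closure_of_subset inf.cobounded1)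
  have "compact_space (subtopology X ?K)"
  proof (rule compact_space_if_separable_Delta)
    show "countably_compact_space (subtopology X ?K)"
      by (simp add: cc countably_compact_closedin)
    show "countable ?A"
      using A by simp
    show "?A \<subseteq> topspace (subtopology X ?K)"
      using sub by auto
    show "subtopology X ?K closure_of ?A = topspace (subtopology X ?K)"
      using sub closure_of_subset_topspace[of X A]
      by (auto simp: closure_of_subtopology_subset closure_of_subtopology Int_absorb1 closure_of_restrict[of X A])
  qed (simp_all add: D reg Delta_space_subtopology regular_space_subtopology)
  then show ?thesis
    by (simp add: compactin_subspace closure_of_subset_topspace)
qed

text \<open>
  A copy of \<open>\<omega>\<^sub>1\<close> inside the power set of the natural numbers. This form of \<open>\<omega>\<^sub>1 \<le> 2\<^sup>\<omega>\<close>
  makes a cover of length \<open>\<omega>\<^sub>1\<close> a cover indexed by \<open>nat set\<close>.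
\<close>

lemma omega1_on_nat_sets:
  "\<exists>(I :: nat set set) (R :: nat set rel). wf R \<and> trans R \<and> R \<subseteq> I \<times> I \<and> uncountable I \<and>
     (\<forall>i\<in>I. countable {j. (j, i) \<in> R}) \<and> (\<forall>i\<in>I. \<forall>j\<in>I. i = j \<or> (i, j) \<in> R \<or> (j, i) \<in> R)"
proof -
  let ?r = "cardSuc natLeq :: nat set rel"
  have card: "Card_order ?r"
    by (simp add: cardSuc_Card_order natLeq_Card_order)
  then have wo: "Well_order ?r"
    by (simp add: card_order_on_well_order_on)
  have countable_iff: "countable A \<longleftrightarrow> |A| \<le>o natLeq" for A :: "'x set"
  proof -
    have "countable A \<longleftrightarrow> |A| \<le>o |UNIV :: nat set|"
      unfolding countable_def card_of_ordLeq[symmetric] by simp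
    then show ?thesis
      using card_of_nat ordIso_symmetric ordLeq_ordIso_trans by blast
  qed
  show ?thesis
  proof (intro exI conjI ballI)
    show "wf (?r - Id)"
      using wo by (simp add: well_order_on_def)
    show "trans (?r - Id)"
      using wo by (simp add: well_order_on_def linear_order_on_def partial_order_on_def
          preorder_on_def trans_diff_Id)
    show "?r - Id \<subseteq> Field ?r \<times> Field ?r"
      by (auto simp: Field_def)
    have "natLeq <o |Field ?r|"
      using cardSuc_greater[OF natLeq_Card_order] card_of_Field_ordIso[OF card]
        ordLess_ordIso_trans ordIso_symmetric by blast
    then show "uncountable (Field ?r)"
      unfolding countable_iff using not_ordLess_ordLeq by blast
    show "countable {j. (j, i) \<in> ?r - Id}" if "i \<in> Field ?r" for i
    proof -
      have "|underS ?r i| <o ?r"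
        by (rule card_of_underS[OF card that])
      then have "|underS ?r i| \<le>o natLeq"
        using cardSuc_ordLeq_ordLess[OF natLeq_Card_order card_of_Card_order] by blast
      moreover have "{j. (j, i) \<in> ?r - Id} = underS ?r i"
        by (auto simp: underS_def)
      ultimately show ?thesis
        by (simp add: countable_iff)
    qed
    show "i = j \<or> (i, j) \<in> ?r - Id \<or> (j, i) \<in> ?r - Id"
      if "i \<in> Field ?r" "j \<in> Field ?r" for i j
      using wo that by (auto simp: well_order_on_def linear_order_on_def total_on_def)
  qed
qed

text \<open>
  A cover without finite subcover yields a sequence \<open>x\<close> of length \<open>\<omega>\<^sub>1\<close> in which each term
  avoids neighbourhoods \<open>\<Union>(W (x ` B j))\<close> of the closures of the earlier segments \<open>B j\<close>, much like
  a free sequence. The union \<open>Y\<close> of those closures then violates \<open>Delta_space_continuum_cover\<close>.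
\<close>

lemma compact_space_if_countably_compact_Delta:
  assumes cc: "countably_compact_space X" and D: "Delta_space X" and reg: "regular_space X"
  shows "compact_space X"
proof (rule ccontr)
  assume "\<not> ?thesis"
  then obtain \<U> where "Ball \<U> (openin X) \<and> topspace X \<subseteq> \<Union>\<U>"
    and "\<not> (\<exists>\<F>. finite \<F> \<and> \<F> \<subseteq> \<U> \<and> topspace X \<subseteq> \<Union>\<F>)"
    unfolding compact_space_def compactin_def by blast
  then have \<U>: "\<And>U. U \<in> \<U> \<Longrightarrow> openin X U" "topspace X \<subseteq> \<Union>\<U>"
    and no: "\<And>\<F>. finite \<F> \<Longrightarrow> \<F> \<subseteq> \<U> \<Longrightarrow> \<not> topspace X \<subseteq> \<Union>\<F>"
    by auto
  have no_countable: "\<not> topspace X \<subseteq> \<Union>\<V>" if \<V>: "countable \<V>" "\<V> \<subseteq> \<U>" for \<V>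
  proof
    assume "topspace X \<subseteq> \<Union>\<V>"
    then obtain \<F> where "finite \<F>" "\<F> \<subseteq> \<V>" "topspace X \<subseteq> \<Union>\<F>"
      using cc[unfolded countably_compact_space_def, rule_format, of \<V>] \<V> \<U>(1) by auto
    then show False
      using no[of \<F>] \<V>(2) by blast
  qed
  have "\<exists>\<W>. countable A \<longrightarrow> finite \<W> \<and> \<W> \<subseteq> \<U> \<and> X closure_of A \<subseteq> \<Union>\<W>" for A
  proof (cases "countable A")
    case True
    have "X closure_of A \<subseteq> \<Union>\<U>"
      using \<U>(2) closure_of_subset_topspace[of X A] by blast
    then show ?thesis
      using compactinD[OF compactin_closure_of_countable[OF cc D reg True], of \<U>] \<U>(1) by auto
  qed simp
  then obtain W where W: "\<And>A. countable A \<Longrightarrow> finite (W A)" "\<And>A. countable A \<Longrightarrow> W A \<subseteq> \<U>"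
      "\<And>A. countable A \<Longrightarrow> X closure_of A \<subseteq> \<Union>(W A)"
    by metis
  obtain I :: "nat set set" and R where R: "wf R" "trans R" "R \<subseteq> I \<times> I" and I: "uncountable I"
    and seg: "\<And>i. i \<in> I \<Longrightarrow> countable {j. (j, i) \<in> R}"
    and total: "\<And>i j. i \<in> I \<Longrightarrow> j \<in> I \<Longrightarrow> i = j \<or> (i, j) \<in> R \<or> (j, i) \<in> R"
    using omega1_on_nat_sets by metis
  define B where "B i = {j. (j, i) \<in> R}" for i
  have B_I: "B i \<subseteq> I" for i
    using R(3) by (auto simp: B_def)
  have B_mono: "B j \<subseteq> B i" if "j \<in> B i" for i j
    using that R(2) by (auto simp: B_def dest: transD)
  have B_countable: "countable (B i)" if "i \<in> I" for i
    using seg[OF that] by (simp add: B_def)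
  \<comment> \<open>Countable subsets of \<open>\<omega>\<^sub>1\<close> are bounded.\<close>
  have bound: "\<exists>k\<in>I. J \<subseteq> B k" if J: "countable J" "J \<subseteq> I" for J
  proof -
    have "countable (\<Union>j\<in>J. insert j (B j))"
      using J B_countable by (intro countable_UN) auto
    then have "\<not> I \<subseteq> (\<Union>j\<in>J. insert j (B j))"
      using I countable_subset by metis
    then obtain k where k: "k \<in> I" "k \<notin> (\<Union>j\<in>J. insert j (B j))"
      by blast
    then have "J \<subseteq> B k"
      using total J(2) by (fastforce simp: B_def)
    with k(1) show ?thesis
      by blast
  qed
  \<comment> \<open>The sets to be avoided at stage \<open>i\<close> are unions of countably many members of \<open>\<U>\<close>, so they leave a point.\<close>
  have "\<exists>x. \<forall>i. i \<in> I \<longrightarrow> x i \<in> topspace X \<and> x i \<notin> (\<Union>j\<in>B i. \<Union>(W (x ` B j)))"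
  proof (rule dependent_wf_choice[OF R(1)])
    fix f g :: "nat set \<Rightarrow> 'a" and i p
    assume "\<And>z. (z, i) \<in> R \<Longrightarrow> f z = g z"
    then have "f ` B j = g ` B j" if "j \<in> B i" for j
      using B_mono[OF that] by (intro image_cong) (auto simp: B_def)
    then show "(i \<in> I \<longrightarrow> p \<in> topspace X \<and> p \<notin> (\<Union>j\<in>B i. \<Union>(W (f ` B j))))
             = (i \<in> I \<longrightarrow> p \<in> topspace X \<and> p \<notin> (\<Union>j\<in>B i. \<Union>(W (g ` B j))))"
      by simp
  next
    fix i and f :: "nat set \<Rightarrow> 'a"
    show "\<exists>p. i \<in> I \<longrightarrow> p \<in> topspace X \<and> p \<notin> (\<Union>j\<in>B i. \<Union>(W (f ` B j)))"
    proof (cases "i \<in> I")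
      case True
      have cnt: "countable (f ` B j)" if "j \<in> B i" for j
        using that B_countable B_I by blast
      have "countable (\<Union>j\<in>B i. W (f ` B j))"
        using B_countable[OF True] W(1)[OF cnt] by (intro countable_UN) (auto intro: countable_finite)
      moreover have "(\<Union>j\<in>B i. W (f ` B j)) \<subseteq> \<U>"
        using W(2)[OF cnt] by blast
      ultimately have "\<not> topspace X \<subseteq> \<Union>(\<Union>j\<in>B i. W (f ` B j))"
        by (rule no_countable)
      then show ?thesis
        by blast
    qed simp
  qed
  then obtain x where x: "\<And>i. i \<in> I \<Longrightarrow> x i \<in> topspace X"
      "\<And>i j. i \<in> I \<Longrightarrow> j \<in> B i \<Longrightarrow> x i \<notin> \<Union>(W (x ` B j))"
    by blast
  define Y where "Y = (\<Union>i\<in>I. X closure_of (x ` B i))"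
  have Y_top: "Y \<subseteq> topspace X"
    unfolding Y_def by (auto dest: subsetD[OF closure_of_subset_topspace])
  have xY: "x i \<in> Y" if "i \<in> I" for i
  proof -
    have "countable {i}" "{i} \<subseteq> I"
      using that by auto
    then obtain k where k: "k \<in> I" "{i} \<subseteq> B k"
      using bound by metis
    have "x ` B k \<subseteq> X closure_of (x ` B k)"
      using B_I x(1) by (intro closure_of_subset) blast
    with k show ?thesis
      unfolding Y_def by blast
  qed
  have "countably_compact_space (subtopology X Y)"
  proof (rule countably_compact_subtopology_if_countable_in_closed[OF Y_top _ cc])
    fix C assume C: "countable C" "C \<subseteq> Y"
    then have "\<forall>c\<in>C. \<exists>i. i \<in> I \<and> c \<in> X closure_of (x ` B i)"
      unfolding Y_def by blast
    then obtain h where h: "\<And>c. c \<in> C \<Longrightarrow> h c \<in> I" "\<And>c. c \<in> C \<Longrightarrow> c \<in> X closure_of (x ` B (h c))"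
      by metis
    obtain k where k: "k \<in> I" "h ` C \<subseteq> B k"
      using bound[of "h ` C"] C(1) h(1) by blast
    have "c \<in> X closure_of (x ` B k)" if "c \<in> C" for c
    proof -
      have "x ` B (h c) \<subseteq> x ` B k"
        using k(2) that by (intro image_mono B_mono) blast
      from closure_of_mono[OF this] h(2)[OF that] show ?thesis
        by blast
    qed
    with k(1) show "\<exists>K. C \<subseteq> K \<and> K \<subseteq> Y \<and> closedin X K"
      by (intro exI[of _ "X closure_of (x ` B k)"]) (auto simp: Y_def)
  qed
  moreover have "Delta_space (subtopology X Y)"
    using D by (rule Delta_space_subtopology)
  moreover define V where "V t = (if t \<in> I then \<Union>(W (x ` B t)) \<inter> Y else {})" for t
  have "openin (subtopology X Y) (V t)" for t
  proof (cases "t \<in> I")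
    case True
    then have "W (x ` B t) \<subseteq> \<U>"
      using W(2) B_countable by simp
    then have "openin X (\<Union>(W (x ` B t)))"
      using \<U>(1) by blast
    with True show ?thesis
      by (simp add: V_def openin_subtopology_Int)
  qed (simp add: V_def)
  moreover have "topspace (subtopology X Y) \<subseteq> (\<Union>t. V t)"
  proof
    fix p assume "p \<in> topspace (subtopology X Y)"
    then have "p \<in> Y"
      by simp
    then obtain i where i: "i \<in> I" "p \<in> X closure_of (x ` B i)"
      unfolding Y_def by blast
    have "X closure_of (x ` B i) \<subseteq> \<Union>(W (x ` B i))"
      using W(3) B_countable[OF i(1)] by simp
    with i \<open>p \<in> Y\<close> have "p \<in> V i"
      by (auto simp: V_def)
    then show "p \<in> (\<Union>t. V t)"
      by blast
  qed
  ultimately obtain T where T: "finite T" "topspace (subtopology X Y) \<subseteq> (\<Union>t\<in>T. V t)"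
    using Delta_space_continuum_cover by metis
  \<comment> \<open>A point chosen after all indices of a finite subcover lies in none of its members.\<close>
  obtain k where k: "k \<in> I" "T \<inter> I \<subseteq> B k"
    using bound[of "T \<inter> I"] T(1) by (auto intro: countable_finite)
  have "x k \<in> (\<Union>t\<in>T. V t)"
    using T(2) xY[OF k(1)] Y_top by auto
  then obtain t where "t \<in> T" "t \<in> I" "x k \<in> \<Union>(W (x ` B t))"
    unfolding V_def by (auto split: if_splits)
  with k x(2)[of k t] show False
    by blast
qed

lemma closedin_if_countably_compact_subtopology:
  assumes "Delta_space X" "regular_space X" "Hausdorff_space X" "S \<subseteq> topspace X"
    and "countably_compact_space (subtopology X S)"
  shows "closedin X S"
proof -
  have "compact_space (subtopology X S)"
    using assms by (intro compact_space_if_countably_compact_Delta Delta_space_subtopology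
        regular_space_subtopology)
  then have "compactin X S"
    using assms(4) by (simp add: compactin_subspace)
  then show ?thesis
    using assms(3) by (simp add: compactin_imp_closedin)
qed

section \<open>Countable tightness\<close>

text \<open>
  The union \<open>Y\<close> of the closures of the countable subsets of \<open>A\<close> is countably compact, hence closed,
  hence contains the closure of \<open>A\<close>.
\<close>

lemma countable_tightness_if_countably_compact_Delta:
  assumes cc: "countably_compact_space X" and D: "Delta_space X" and reg: "regular_space X"
    and H: "Hausdorff_space X"
  shows "countable_tightness X"
  unfolding countable_tightness_def
proof (intro allI impI)
  fix A x assume A: "A \<subseteq> topspace X \<and> x \<in> X closure_of A"
  define Y where "Y = \<Union>{X closure_of B | B. countable B \<and> B \<subseteq> A}"
  have Y_top: "Y \<subseteq> topspace X"
    unfolding Y_def by (auto dest: subsetD[OF closure_of_subset_topspace])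
  have "countably_compact_space (subtopology X Y)"
  proof (rule countably_compact_subtopology_if_countable_in_closed[OF Y_top _ cc])
    fix C assume C: "countable C" "C \<subseteq> Y"
    then have "\<forall>c\<in>C. \<exists>B. countable B \<and> B \<subseteq> A \<and> c \<in> X closure_of B"
      unfolding Y_def by blast
    then obtain h where h: "\<And>c. c \<in> C \<Longrightarrow> countable (h c)" "\<And>c. c \<in> C \<Longrightarrow> h c \<subseteq> A"
        "\<And>c. c \<in> C \<Longrightarrow> c \<in> X closure_of (h c)"
      by metis
    have "countable (\<Union>(h ` C))" "\<Union>(h ` C) \<subseteq> A"
      using C(1) h(1,2) by auto
    moreover have "c \<in> X closure_of (\<Union>(h ` C))" if "c \<in> C" for c
      using closure_of_mono[of "h c" "\<Union>(h ` C)" X] h(3)[OF that] that by blast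
    ultimately show "\<exists>K. C \<subseteq> K \<and> K \<subseteq> Y \<and> closedin X K"
      by (intro exI[of _ "X closure_of (\<Union>(h ` C))"]) (auto simp: Y_def)
  qed
  then have "closedin X Y"
    by (rule closedin_if_countably_compact_subtopology[OF D reg H Y_top])
  moreover have "A \<subseteq> Y"
  proof
    fix a assume a: "a \<in> A"
    then have "a \<in> X closure_of {a}"
      using A closure_of_subset[of "{a}" X] by auto
    moreover have "countable {a}" "{a} \<subseteq> A"
      using a by auto
    ultimately show "a \<in> Y"
      unfolding Y_def by blast
  qed
  ultimately have "X closure_of A \<subseteq> Y"
    by (simp add: closure_of_minimal)
  with A have "x \<in> Y"
    by blast
  then show "\<exists>B\<subseteq>A. countable B \<and> x \<in> X closure_of B"
    unfolding Y_def by blast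
qed

section \<open>Sequentiality\<close>

lemma dense_in_itself_minus_finite:
  assumes t1: "t1_space X" and Q: "Q \<subseteq> topspace X" "\<And>q. q \<in> Q \<Longrightarrow> q \<in> X closure_of (Q - {q})"
    and F: "finite F"
  shows "Q \<subseteq> X closure_of (Q - F)"
proof
  fix q assume q: "q \<in> Q"
  have "\<exists>z. z \<in> Q - F \<and> z \<in> U" if U: "q \<in> U" "openin X U" for U
  proof (cases "q \<in> F")
    case True
    have "closedin X (topspace X \<inter> (F - {q}))"
      using t1 F by (auto simp: t1_space_closedin_finite)
    then have "openin X (U - (topspace X \<inter> (F - {q})))"
      using U(2) by (rule openin_diff[rotated])
    moreover have "q \<in> U - (topspace X \<inter> (F - {q}))"
      using U(1) by simp
    ultimately obtain z where "z \<in> Q - {q}" "z \<in> U - (topspace X \<inter> (F - {q}))"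
      using Q(2)[OF q] unfolding in_closure_of by meson
    then show ?thesis
      using Q(1) by blast
  qed (use q U in blast)
  with q Q(1) show "q \<in> X closure_of (Q - F)"
    by (auto simp: in_closure_of)
qed

text \<open>
  Compact \<open>\<Delta>\<close>-spaces of countable tightness are scattered. Tightness replaces a counterexample \<open>L\<close>
  by a countable \<open>Q\<close>; deleting the first \<open>n\<close> elements of \<open>Q\<close> gives sets \<open>D' n\<close> dense in \<open>Q\<close> with
  empty intersection, and their open expansions are dense open subsets of the compact closure of
  \<open>Q\<close> with empty intersection.
\<close>

lemma Delta_space_isolated_point:
  assumes cpt: "compact_space X" and D: "Delta_space X" and reg: "regular_space X"
    and H: "Hausdorff_space X" and tight: "countable_tightness X"
    and L: "L \<subseteq> topspace X" "L \<noteq> {}"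
  shows "\<exists>p\<in>L. p \<notin> X closure_of (L - {p})"
proof (rule ccontr)
  assume "\<not> ?thesis"
  then have acc: "p \<in> X closure_of (L - {p})" if "p \<in> L" for p
    using that by blast
  have "\<exists>B. p \<in> L \<longrightarrow> B \<subseteq> L - {p} \<and> countable B \<and> p \<in> X closure_of B" for p
  proof (cases "p \<in> L")
    case True
    have "L - {p} \<subseteq> topspace X"
      using L(1) by blast
    with acc[OF True] show ?thesis
      using tight[unfolded countable_tightness_def, rule_format, of "L - {p}" p] by simp
  qed simp
  then obtain b where b: "\<And>p. p \<in> L \<Longrightarrow> b p \<subseteq> L - {p}" "\<And>p. p \<in> L \<Longrightarrow> countable (b p)"
      "\<And>p. p \<in> L \<Longrightarrow> p \<in> X closure_of (b p)"
    by metis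
  obtain p\<^sub>0 where p\<^sub>0: "p\<^sub>0 \<in> L"
    using L(2) by blast
  \<comment> \<open>Closing \<open>{p\<^sub>0}\<close> under \<open>b\<close> makes every point an accumulation point of the rest.\<close>
  define stage where "stage n = ((\<lambda>S. S \<union> \<Union>(b ` S)) ^^ n) {p\<^sub>0}" for n
  have stage_Suc: "stage (Suc n) = stage n \<union> \<Union>(b ` stage n)" for n
    by (simp add: stage_def)
  have stage: "stage n \<subseteq> L \<and> countable (stage n)" for n
  proof (induction n)
    case 0
    then show ?case using p\<^sub>0 by (simp add: stage_def)
  next
    case (Suc n)
    then have "\<Union>(b ` stage n) \<subseteq> L" "countable (\<Union>(b ` stage n))"
      using b(1,2) by (blast, intro countable_UN) auto
    with Suc show ?case
      by (simp add: stage_Suc)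
  qed
  define Q where "Q = (\<Union>n. stage n)"
  have Q: "Q \<subseteq> L" "countable Q" "Q \<noteq> {}"
    using stage p\<^sub>0 by (auto simp: Q_def stage_def intro: exI[of _ 0])
  have Q_top: "Q \<subseteq> topspace X"
    using Q(1) L(1) by blast
  have crowded: "q \<in> X closure_of (Q - {q})" if q: "q \<in> Q" for q
  proof -
    have qL: "q \<in> L"
      using q Q(1) by blast
    obtain n where "q \<in> stage n"
      using q by (auto simp: Q_def)
    then have "b q \<subseteq> stage (Suc n)"
      by (auto simp: stage_Suc)
    then have "b q \<subseteq> Q - {q}"
      using b(1)[OF qL] by (auto simp: Q_def)
    with b(3)[OF qL] show ?thesis
      using closure_of_mono by blast
  qed
  define D' where "D' n = Q - from_nat_into Q ` {..<n}" for n :: nat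
  have dense: "Q \<subseteq> X closure_of (D' n)" for n
    unfolding D'_def
    using Hausdorff_imp_t1_space[OF H] Q_top crowded by (rule dense_in_itself_minus_finite) auto
  have "(\<Inter>n. D' n) = {}"
  proof (intro equals0I)
    fix q assume q: "q \<in> (\<Inter>n. D' n)"
    then have "q \<in> Q"
      by (auto simp: D'_def)
    then obtain n where "q = from_nat_into Q n"
      using from_nat_into_surj Q(2) by metis
    then have "q \<notin> D' (Suc n)"
      by (auto simp: D'_def)
    with q show False
      by blast
  qed
  moreover have "\<forall>n. D' n \<subseteq> topspace X" "decseq D'"
    using Q_top by (auto simp: D'_def decseq_def)
  ultimately obtain V where
    V: "\<And>n. openin X (V n)" "(\<Inter>n. V n) = {}" "\<And>n. D' n \<subseteq> V n"
    using D[unfolded Delta_space_def, rule_format, of D'] by auto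
  define K where "K = X closure_of Q"
  have QK: "Q \<subseteq> K"
    using Q_top by (simp add: K_def closure_of_subset)
  have K_top: "topspace (subtopology X K) = K"
    using closure_of_subset_topspace[of X Q] by (auto simp: K_def)
  have "subtopology X K closure_of \<Inter>(range (\<lambda>n. V n \<inter> K)) = topspace (subtopology X K)"
  proof (rule Baire_category)
    have "compact_space (subtopology X K)"
      using cpt by (simp add: K_def closedin_compact_space compact_space_subtopology)
    then show "completely_metrizable_space (subtopology X K) \<or>
        locally_compact_space (subtopology X K) \<and> regular_space (subtopology X K)"
      using reg by (simp add: regular_space_subtopology compact_imp_locally_compact_space)
    fix G assume "G \<in> range (\<lambda>n. V n \<inter> K)"
    then obtain n where G: "G = V n \<inter> K"
      by blast
    have "D' n \<subseteq> G"
      using V(3)[of n] QK by (auto simp: D'_def G)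
    then have "X closure_of (D' n) \<subseteq> X closure_of G"
      by (rule closure_of_mono)
    moreover have "K \<subseteq> X closure_of (D' n)"
      unfolding K_def using dense by (simp add: closure_of_minimal)
    ultimately have "K \<subseteq> X closure_of G"
      by blast
    moreover have "K \<inter> G = G"
      by (auto simp: G)
    ultimately have "subtopology X K closure_of G = topspace (subtopology X K)"
      unfolding K_top by (simp add: closure_of_subtopology Int_absorb2)
    then show "openin (subtopology X K) G \<and>
        subtopology X K closure_of G = topspace (subtopology X K)"
      using V(1) by (simp add: G openin_subtopology_Int)
  qed simp
  moreover have "\<Inter>(range (\<lambda>n. V n \<inter> K)) = {}"
    using V(2) by blast
  ultimately have "K = {}"
    using K_top by simp
  with QK Q(3) show False
    by blast
qed

lemma cluster_point_subsequence:
  assumes "cluster_point X (y \<circ> r) p" "strict_mono r"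
  shows "cluster_point X y p"
  unfolding cluster_point_def
proof (intro conjI allI impI)
  show "p \<in> topspace X"
    using assms(1) by (simp add: cluster_point_def)
  fix U assume "openin X U \<and> p \<in> U"
  then have inf: "\<exists>\<^sub>\<infinity>n. y (r n) \<in> U"
    using assms(1) by (simp add: cluster_point_def)
  show "\<exists>\<^sub>\<infinity>n. y n \<in> U"
    unfolding INFM_nat_le
  proof
    fix m
    obtain n where "n \<ge> m" "y (r n) \<in> U"
      using inf by (auto simp: INFM_nat_le)
    then show "\<exists>n\<ge>m. y n \<in> U"
      using seq_suble[OF assms(2), of n] by (intro exI[of _ "r n"]) simp
  qed
qed

text \<open>
  Let \<open>p\<close> be isolated in the set \<open>L\<close> of cluster points. The terms in a small neighbourhood of \<open>p\<close>
  form a subsequence whose only possible cluster point is \<open>p\<close>, which by countable compactness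
  forces convergence to \<open>p\<close>.
\<close>

lemma Delta_space_convergent_subsequence:
  fixes y :: "nat \<Rightarrow> 'a"
  assumes cc: "countably_compact_space X" and D: "Delta_space X" and reg: "regular_space X"
    and H: "Hausdorff_space X" and y: "range y \<subseteq> topspace X"
  shows "\<exists>r p. strict_mono r \<and> limitin X (y \<circ> r) p sequentially"
proof -
  define L where "L = {p. cluster_point X y p}"
  have "L \<subseteq> topspace X" "L \<noteq> {}"
    using countably_compact_space_imp_cluster_point[OF cc y] by (auto simp: L_def cluster_point_def)
  then obtain p where p: "p \<in> L" "p \<notin> X closure_of (L - {p})"
    using Delta_space_isolated_point compact_space_if_countably_compact_Delta[OF cc D reg]
      countable_tightness_if_countably_compact_Delta[OF cc D reg H] D reg H by metis
  then have p_top: "p \<in> topspace X"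
    by (simp add: L_def cluster_point_def)
  define U where "U = topspace X - X closure_of (L - {p})"
  have U: "openin X U" "p \<in> U"
    using p(2) p_top unfolding U_def by (auto intro: openin_diff)
  have UL: "U \<inter> L \<subseteq> {p}"
    using closure_of_subset[of "L - {p}" X] \<open>L \<subseteq> topspace X\<close> unfolding U_def by blast
  obtain W K where W: "openin X W" "closedin X K" "p \<in> W" "W \<subseteq> K" "K \<subseteq> U"
    using reg U unfolding neighbourhood_base_of_closedin[symmetric] neighbourhood_base_of by metis
  have "infinite {n. y n \<in> W}"
    using p(1) W(1,3) by (auto simp: L_def cluster_point_def frequently_cofinite)
  then obtain r :: "nat \<Rightarrow> nat" where r: "strict_mono r" "\<And>n. y (r n) \<in> W"
    using infinite_enumerate by blast
  have "limitin X (y \<circ> r) p sequentially"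
  proof (rule ccontr)
    assume "\<not> ?thesis"
    then obtain V where V: "openin X V" "p \<in> V" "\<And>N. \<exists>n\<ge>N. y (r n) \<notin> V"
      using p_top by (auto simp: limitin_sequentially)
    then have "\<exists>\<^sub>\<infinity>n. y (r n) \<notin> V"
      by (simp add: INFM_nat_le)
    then have "infinite {n. y (r n) \<notin> V}"
      by (simp add: frequently_cofinite)
    then obtain s :: "nat \<Rightarrow> nat" where s: "strict_mono s" "\<And>n. y (r (s n)) \<notin> V"
      using infinite_enumerate by blast
    have "range (y \<circ> r \<circ> s) \<subseteq> topspace X"
      using y by auto
    then obtain q where q: "cluster_point X (y \<circ> r \<circ> s) q"
      using countably_compact_space_imp_cluster_point[OF cc] by blast
    have "q \<in> K - V"
    proof (rule cluster_point_in_closedin[OF q])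
      show "closedin X (K - V)"
        using W(2) V(1) by (rule closedin_diff)
      show "\<forall>\<^sub>\<infinity>n. (y \<circ> r \<circ> s) n \<in> K - V"
        using r(2) s(2) W(4) by (auto simp: MOST_nat)
    qed
    moreover have "cluster_point X y q"
      by (rule cluster_point_subsequence[OF cluster_point_subsequence[OF q s(1)] r(1)])
    ultimately show False
      using UL W(5) V(2) by (auto simp: L_def)
  qed
  with r(1) show ?thesis
    by blast
qed

lemma sequential_space_if_countably_compact_Delta:
  assumes cc: "countably_compact_space X" and D: "Delta_space X" and reg: "regular_space X"
    and H: "Hausdorff_space X"
  shows "sequential_space X"
  unfolding sequential_space_def
proof (intro allI impI)
  fix S assume "sequentially_closedin X S"
  then have S: "S \<subseteq> topspace X"
    and lim: "\<And>(\<sigma> :: nat \<Rightarrow> 'a) x. range \<sigma> \<subseteq> S \<Longrightarrow> limitin X \<sigma> x sequentially \<Longrightarrow> x \<in> S"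
    unfolding sequentially_closedin_def by auto
  have "countably_compact_space (subtopology X S)"
  proof (rule countably_compact_subtopologyI[OF S])
    fix y :: "nat \<Rightarrow> 'a" assume y: "range y \<subseteq> S"
    with S have "range y \<subseteq> topspace X"
      by (rule order_trans[rotated])
    then obtain r p where r: "strict_mono r" "limitin X (y \<circ> r) p sequentially"
      using Delta_space_convergent_subsequence[OF cc D reg H, of y] by blast
    have "p \<in> S"
      using y by (intro lim[OF _ r(2)]) auto
    moreover have cl: "cluster_point X (y \<circ> r) p"
      unfolding cluster_point_def
    proof (intro conjI allI impI)
      show "p \<in> topspace X"
        using r(2) by (simp add: limitin_sequentially)
      fix U assume "openin X U \<and> p \<in> U"
      then obtain N where "\<And>n. n \<ge> N \<Longrightarrow> (y \<circ> r) n \<in> U"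
        using r(2) unfolding limitin_sequentially by blast
      then show "\<exists>\<^sub>\<infinity>n. (y \<circ> r) n \<in> U"
        unfolding INFM_nat_le by (meson max.cobounded1 max.cobounded2)
    qed
    ultimately show "\<exists>p\<in>S. cluster_point X y p"
      using cluster_point_subsequence[OF cl r(1)] by blast
  qed
  then show "closedin X S"
    by (rule closedin_if_countably_compact_subtopology[OF D reg H S])
qed

lemma compact_imp_countably_compact_space:
  "compact_space X \<Longrightarrow> countably_compact_space X"
  unfolding compact_space_def compactin_def countably_compact_space_def by simp

lemma tychonoff_space_imp:
  assumes "tychonoff_space X"
  shows "regular_space X" "Hausdorff_space X"
  using assms completely_regular_imp_regular_space regular_t1_imp_Hausdorff_space
  unfolding tychonoff_space_def by blast+

theorem theorem4p3:
  assumes "PFA TYPE('a set set set set set set)"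
  shows
    "(\<forall>X :: 'a topology. tychonoff_space X \<and> countably_compact_space X \<and> Delta_space X
        \<longrightarrow> compact_space X) \<and>
     (\<forall>X :: 'a topology. tychonoff_space X \<and> countably_compact_space X \<and> Delta_space X
        \<longrightarrow> countable_tightness X) \<and>
     (\<forall>X :: 'a topology. tychonoff_space X \<and> countably_compact_space X \<and> Delta_space X
        \<longrightarrow> sequential_space X) \<and>
     (\<forall>X :: 'a topology. tychonoff_space X \<and> compact_space X \<and> Delta_space X
        \<longrightarrow> sequential_space X)"
proof (intro conjI allI impI; elim conjE)
  fix X :: "'a topology"
  assume "tychonoff_space X" and D: "Delta_space X"
  then have reg: "regular_space X" and H: "Hausdorff_space X"
    by (simp_all add: tychonoff_space_imp)
  show "compact_space X" if "countably_compact_space X"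
    using that D reg by (rule compact_space_if_countably_compact_Delta)
  show "countable_tightness X" if "countably_compact_space X"
    using that D reg H by (rule countable_tightness_if_countably_compact_Delta)
  show "sequential_space X" if "countably_compact_space X"
    using that D reg H by (rule sequential_space_if_countably_compact_Delta)
  show "sequential_space X" if "compact_space X"
    using compact_imp_countably_compact_space[OF that] D reg H
    by (rule sequential_space_if_countably_compact_Delta)
qed

end
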